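(* Let $p\in[1,\infty)$ with Hölder conjugate $p'$. (1) For all $u\in L^p(\Omega_\delta)$ and $\vec v=(v_1,\dots,v_d)\in L^{p'}(\Omega_\delta)^d$, $$\langle\mathscr{G}_\delta u,\vec v\rangle=\langle u,-\mathscr{D}_\delta\vec v\rangle+\mathsf{A},$$ where $$\mathsf{A}=\int_{\Gamma_{-\delta}}\int_{\Gamma_\delta}\Bigl([u(y)\vec v(x)+u(x)\vec v(y)]\cdot\vec\mu_\delta(y-x)-2u(x)\,\vec v(y)\cdot\vec\mu_s(y-x)\Bigr)\,dy\,dx+\sum_{k=1}^d2\langle u,\overline{\mathcal{D}}_{s,k}v_k\rangle.$$ (2) Suppose that $\vec\mu_\delta$ has antisymmetric components, $u\in L^p_0(\Omega_\delta)$ and $\vec v\in L^{p'}_0(\Omega_\delta)^d$. Then $\langle\mathscr{G}_\delta u,\vec v\rangle=\langle u,-\mathscr{D}_\delta\vec v\rangle$. (3) Suppose that $\vec\mu_\delta$ has antisymmetric components. Then for all $\vec v\in L^{p'}(\Omega_\delta)^d$, $$\int_{\Omega_\delta}\mathscr{D}_\delta\vec v\,dx=\int_{\Gamma_{-\delta}}\int_{\Gamma_\delta}[\vec v(x)+\vec v(y)]\cdot\vec\mu_\delta(y-x)\,dy\,dx.$$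
   Context: $\Omega\subseteq\mathbb{R}^d$ is open and bounded and $\delta>0$. The collar is $\Gamma_\delta=\left(\bigcup_{x\in\Omega}\overline{B_\delta(x)}\right)\setminus\Omega$, $\Omega_\delta=\Omega\cup\Gamma_\delta$, the inner collar is $\Gamma_{-\delta}=\{x\in\Omega:d(x,\partial\Omega)\le\delta\}$, and $L^q_0(\Omega_\delta)=\{u\in L^q(\Omega_\delta):u=0\text{ a.e. in }\Gamma_\delta\}$. For a real-valued kernel $\mu\in L^1(\mathbb{R}^d)$ supported in $\overline{B_\delta(0)}$, the extended nonlocal derivative with kernel $\mu$ sends $u$ to the function on $\Omega_\delta$ given by $\chi_\Omega(x)\int_{\Omega_\delta}[u(y)-u(x)]\mu(y-x)\chi_{B_\delta(x)}(y)\,dy$. Let $\vec\mu_\delta=(\mu_{\delta,1},\dots,\mu_{\delta,d})\in L^1(\mathbb{R}^d)^d$ with $\operatorname{supp}\vec\mu_\delta\subseteq\overline{B_\delta(0)}$; let $\overline{\mathcal{D}_{\delta,k}}$ be the extended nonlocal derivative with kernel $\mu_{\delta,k}$; let $\vec\mu_s=(\mu_{s,1},\dots,\mu_{s,d})$ with $\mu_{s,k}(z)=\tfrac12(\mu_{\delta,k}(z)+\mu_{\delta,k}(-z))$; and let $\overline{\mathcal{D}}_{s,k}$ be the extended nonlocal derivative with kernel $\mu_{s,k}$. The nonlocal gradient is $\mathscr{G}_\delta u=(\overline{\mathcal{D}_{\delta,1}}u,\dots,\overline{\mathcal{D}_{\delta,d}}u)$ and the nonlocal divergence is $\mathscr{D}_\delta\vec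 v=\sum_{k=1}^d\overline{\mathcal{D}_{\delta,k}}v_k$. Functions are real-valued; $\langle u,v\rangle=\int_{\Omega_\delta}uv\,dx$ for scalar functions and $\langle\vec u,\vec v\rangle=\sum_{k=1}^d\langle u_k,v_k\rangle$ for vector-valued ones. *)

theory Defs
  imports "HOL-Analysis.Analysis" "HOL-Probability.Essential_Supremum"
begin

text \<open>
  \<open>\<real>\<^sup>d\<close> is \<^typ>\<open>real ^ 'd\<close>. Elements of Lebesgue spaces are represented by Lebesgue measurable
  functions on the whole space, of which only the values on the set in question matter.
  Vector fields are \<^typ>\<open>real ^ 'd\<close>-valued.
\<close>

definition collar :: "'a::metric_space set \<Rightarrow> real \<Rightarrow> 'a set" where
  "collar \<Omega> \<delta> = (\<Union>x\<in>\<Omega>. cball x \<delta>) - \<Omega>"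

definition nl_domain :: "'a::metric_space set \<Rightarrow> real \<Rightarrow> 'a set" where
  "nl_domain \<Omega> \<delta> = \<Omega> \<union> collar \<Omega> \<delta>"

definition inner_collar :: "'a::metric_space set \<Rightarrow> real \<Rightarrow> 'a set" where
  "inner_collar \<Omega> \<delta> = {x \<in> \<Omega>. infdist x (frontier \<Omega>) \<le> \<delta>}"

definition Lq :: "ennreal \<Rightarrow> 'a::euclidean_space set \<Rightarrow> ('a \<Rightarrow> real) set" where
  "Lq q S = {u \<in> borel_measurable (lebesgue_on S).
     if q = \<infinity> then esssup (lebesgue_on S) (\<lambda>x. ereal \<bar>u x\<bar>) < \<infinity>
     else integrable (lebesgue_on S) (\<lambda>x. \<bar>u x\<bar> powr enn2real q)}"

definition Lq0 :: "ennreal \<Rightarrow> 'a::euclidean_space set \<Rightarrow> real \<Rightarrow> ('a \<Rightarrow> real) set" where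
  "Lq0 q \<Omega> \<delta> = {u \<in> Lq q (nl_domain \<Omega> \<delta>). AE x in lebesgue_on (collar \<Omega> \<delta>). u x = 0}"

definition Lq_vec :: "ennreal \<Rightarrow> 'a::euclidean_space set \<Rightarrow> ('a \<Rightarrow> real ^ 'd) set" where
  "Lq_vec q S = {v. \<forall>k. (\<lambda>x. v x $ k) \<in> Lq q S}"

definition Lq0_vec :: "ennreal \<Rightarrow> 'a::euclidean_space set \<Rightarrow> real \<Rightarrow> ('a \<Rightarrow> real ^ 'd) set" where
  "Lq0_vec q \<Omega> \<delta> = {v. \<forall>k. (\<lambda>x. v x $ k) \<in> Lq0 q \<Omega> \<delta>}"

text \<open>
  The support of an a.e. class of functions: the complement of the largest open set on which the
  function vanishes almost everywhere.
\<close>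

definition ess_supp :: "('a::euclidean_space \<Rightarrow> 'b::zero) \<Rightarrow> 'a set" where
  "ess_supp f = - \<Union>{U. open U \<and> (AE x in lebesgue. x \<in> U \<longrightarrow> f x = 0)}"

definition nl_deriv ::
    "'a::euclidean_space set \<Rightarrow> real \<Rightarrow> ('a \<Rightarrow> real) \<Rightarrow> ('a \<Rightarrow> real) \<Rightarrow> 'a \<Rightarrow> real" where
  "nl_deriv \<Omega> \<delta> \<mu> u x = indicat_real \<Omega> x *
     (\<integral>y. (u y - u x) * \<mu> (y - x) * indicat_real (ball x \<delta>) y \<partial>lebesgue_on (nl_domain \<Omega> \<delta>))"

definition nl_grad ::
    "(real ^ 'd) set \<Rightarrow> real \<Rightarrow> (real ^ 'd \<Rightarrow> real ^ 'd) \<Rightarrow> (real ^ 'd \<Rightarrow> real) \<Rightarrow>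
     real ^ 'd \<Rightarrow> real ^ 'd" where
  "nl_grad \<Omega> \<delta> \<mu> u x = (\<chi> k. nl_deriv \<Omega> \<delta> (\<lambda>z. \<mu> z $ k) u x)"

definition nl_div ::
    "(real ^ 'd) set \<Rightarrow> real \<Rightarrow> (real ^ 'd \<Rightarrow> real ^ 'd) \<Rightarrow> (real ^ 'd \<Rightarrow> real ^ 'd) \<Rightarrow>
     real ^ 'd \<Rightarrow> real" where
  "nl_div \<Omega> \<delta> \<mu> v x = (\<Sum>k\<in>UNIV. nl_deriv \<Omega> \<delta> (\<lambda>z. \<mu> z $ k) (\<lambda>y. v y $ k) x)"

definition sym_part :: "(real ^ 'd \<Rightarrow> real ^ 'd) \<Rightarrow> real ^ 'd \<Rightarrow> real ^ 'd" where
  "sym_part \<mu> z = (\<chi> k. 1 / 2 * (\<mu> z $ k + \<mu> (- z) $ k))"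

text \<open>Kernels are a.e. classes, so antisymmetry is understood almost everywhere.\<close>

definition antisym_components :: "(real ^ 'd \<Rightarrow> real ^ 'd) \<Rightarrow> bool" where
  "antisym_components \<mu> \<longleftrightarrow> (\<forall>k. AE z in lebesgue. \<mu> (- z) $ k = - (\<mu> z $ k))"

definition pairing ::
    "'a::euclidean_space set \<Rightarrow> real \<Rightarrow> ('a \<Rightarrow> real) \<Rightarrow> ('a \<Rightarrow> real) \<Rightarrow> real" where
  "pairing \<Omega> \<delta> u v = (\<integral>x. u x * v x \<partial>lebesgue_on (nl_domain \<Omega> \<delta>))"

definition pairing_vec ::
    "'a::euclidean_space set \<Rightarrow> real \<Rightarrow> ('a \<Rightarrow> real ^ 'd) \<Rightarrow> ('a \<Rightarrow> real ^ 'd) \<Rightarrow> real" where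
  "pairing_vec \<Omega> \<delta> u v = (\<Sum>k\<in>UNIV. pairing \<Omega> \<delta> (\<lambda>x. u x $ k) (\<lambda>x. v x $ k))"

definition correction_A ::
    "(real ^ 'd) set \<Rightarrow> real \<Rightarrow> (real ^ 'd \<Rightarrow> real ^ 'd) \<Rightarrow> (real ^ 'd \<Rightarrow> real) \<Rightarrow>
     (real ^ 'd \<Rightarrow> real ^ 'd) \<Rightarrow> real" where
  "correction_A \<Omega> \<delta> \<mu> u v =
     (\<integral>x. (\<integral>y. (u y *\<^sub>R v x + u x *\<^sub>R v y) \<bullet> \<mu> (y - x) - 2 * u x * (v y \<bullet> sym_part \<mu> (y - x))
             \<partial>lebesgue_on (collar \<Omega> \<delta>)) \<partial>lebesgue_on (inner_collar \<Omega> \<delta>))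
     + (\<Sum>k\<in>UNIV. 2 * pairing \<Omega> \<delta> u (nl_deriv \<Omega> \<delta> (\<lambda>z. sym_part \<mu> z $ k) (\<lambda>x. v x $ k)))"

end

theory Submission imports Defs begin

text \<open>
  Everything reduces to the scalar identity behind part (1), applied to each component \<open>m\<close> of the
  kernel. Write \<open>W\<close> for \<open>\<Omega>\<^sub>\<delta>\<close> and express all terms as integrals of
  products \<open>u(\<cdot>) v(\<cdot>) m(\<plusminus>(y - x))\<close> over \<open>\<Omega> \<times> W\<close>. In the difference of the
  two sides the terms over \<open>\<Omega> \<times> \<Gamma>\<^sub>\<delta>\<close> containing both \<open>u\<close> and \<open>v\<close> at different points cancel,
  because \<open>A\<close> was built for this, and what is left is the integral of
    \<open>\<chi>\<^sub>\<Omega>(x) \<chi>\<^sub>\<Omega>(y) [v(x) u(y) m(y - x) - u(x) v(y) m(x - y)]\<close>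
  plus the integral of
    \<open>\<chi>\<^sub>\<Omega>(x) \<chi>\<^sub>W(y) u(x) v(x) [m(x - y) - m(y - x)]\<close>.
  The first integrand changes sign when \<open>x\<close> and \<open>y\<close> are exchanged, so it integrates to zero. In the
  second, \<open>W\<close> contains the ball of radius \<open>\<delta>\<close> about each \<open>x \<in> \<Omega>\<close>, so integrating in \<open>y\<close>
  gives \<open>u(x) v(x)\<close> times the difference of the integral of \<open>m\<close> over the whole space with itself
  (\<open>integral_deriv_density_by_parts\<close>). Replacing \<open>\<Omega>\<close> by \<open>\<Gamma>\<^bsub>-\<delta>\<^esub>\<close> in \<open>A\<close> costs nothing, since a point of
  \<open>\<Omega>\<close> closer than \<open>\<delta>\<close> to the complement of \<open>\<Omega>\<close> lies in \<open>\<Gamma>\<^bsub>-\<delta>\<^esub>\<close>.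

  Splitting these integrals and applying Fubini needs each product to be absolutely integrable on
  the product space. Young's inequality (for \<open>p = 1\<close>, boundedness of \<open>v\<close>) gives
  \<open>\<bar>u(x) v(y)\<bar> \<le> a(x) + b(y)\<close> with \<open>a\<close> and \<open>b\<close> integrable, so it suffices that
  \<open>a(x) m(y - x)\<close> and \<open>b(y) m(y - x)\<close> are integrable, which is Tonelli's theorem and translation
  invariance (\<open>dual_pair_dominated\<close>, \<open>integrable_dominated_times_kernel\<close>).

  The map \<open>(x, y) \<mapsto> y - x\<close> is not measurable from the product of two copies of the Lebesgue
  \<open>\<sigma>\<close>-algebra to the Lebesgue \<open>\<sigma>\<close>-algebra. Hence \<open>u\<close>, \<open>v\<close> and \<open>\<mu>\<close> are first replaced by Borel
  functions equal to them almost everywhere, and Fubini's theorem is used for Borel-Lebesgue measure.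

  For an antisymmetric kernel the even part vanishes almost everywhere, so \<open>A\<close> is reduced to its
  first bracket. That bracket vanishes when \<open>u\<close> and \<open>v\<close> are zero on the collar, which is part (2);
  for \<open>u = 1\<close>, whose nonlocal gradient is zero, part (1) becomes part (3).
\<close>

section \<open>Isometries, Borel representatives and null sets\<close>

text \<open>
  The cases \<open>c = 1\<close> and \<open>c = -1\<close> give the two substitutions \<open>y \<mapsto> y - x\<close> and \<open>y \<mapsto> x - y\<close> in which
  kernels are evaluated.
\<close>

lemma distr_lborel_isometry:
  fixes t :: "'a::euclidean_space"
  assumes "\<bar>c\<bar> = 1"
  shows "distr lborel borel (\<lambda>x. t + c *\<^sub>R x) = lborel"
  using lborel_affine[of c t] assms by (auto simp: density_1)

lemma integrable_lborel_shift:
  fixes m :: "'a::euclidean_space \<Rightarrow> real"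
  assumes "integrable lborel m"
  shows "integrable lborel (\<lambda>y. m (y - x))" "integrable lborel (\<lambda>y. m (x - y))"
proof -
  have "integrable lborel (\<lambda>y. m (t + c *\<^sub>R y))" if "\<bar>c\<bar> = 1" for c t
    using integrable_distr[of "\<lambda>y. t + c *\<^sub>R y" lborel borel m] that assms
    by (simp add: distr_lborel_isometry)
  from this[of 1 "-x"] this[of "-1" x]
  show "integrable lborel (\<lambda>y. m (y - x))" "integrable lborel (\<lambda>y. m (x - y))" by simp_all
qed

lemma integral_lborel_shift:
  fixes m :: "'a::euclidean_space \<Rightarrow> real"
  assumes [measurable]: "m \<in> borel_measurable borel"
  shows "(\<integral>y. m (y - x) \<partial>lborel) = (\<integral>y. m y \<partial>lborel)" "(\<integral>y. m (x - y) \<partial>lborel) = (\<integral>y. m y \<partial>lborel)"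
proof -
  have "(\<integral>y. m (t + c *\<^sub>R y) \<partial>lborel) = (\<integral>y. m y \<partial>lborel)" if "\<bar>c\<bar> = 1" for c t
    using integral_distr[of "\<lambda>y. t + c *\<^sub>R y" lborel borel m] that by (simp add: distr_lborel_isometry)
  from this[of 1 "-x"] this[of "-1" x]
  show "(\<integral>y. m (y - x) \<partial>lborel) = (\<integral>y. m y \<partial>lborel)" "(\<integral>y. m (x - y) \<partial>lborel) = (\<integral>y. m y \<partial>lborel)"
    by simp_all
qed

lemma AE_lborel_shift:
  fixes P :: "'a::euclidean_space \<Rightarrow> bool"
  assumes "AE z in lborel. P z"
  shows "AE y in lborel. P (y - x)" "AE y in lborel. P (x - y)"
proof -
  obtain N where N: "{z. \<not> P z} \<subseteq> N" "N \<in> null_sets lborel"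
    using assms by (auto simp: eventually_ae_filter)
  have "AE y in lborel. P (t + c *\<^sub>R y)" if "\<bar>c\<bar> = 1" for c t
  proof -
    have "AE z in distr lborel borel (\<lambda>y. t + c *\<^sub>R y). z \<notin> N"
      using N(2) that by (simp add: distr_lborel_isometry AE_not_in)
    then have "AE y in lborel. t + c *\<^sub>R y \<notin> N"
      using N(2) by (subst (asm) AE_distr_iff) auto
    then show ?thesis by (rule eventually_mono) (use N(1) in auto)
  qed
  from this[of 1 "-x"] this[of "-1" x]
  show "AE y in lborel. P (y - x)" "AE y in lborel. P (x - y)" by simp_all
qed

text \<open>
  By completeness, an almost everywhere equality carries measurability over. This spares separate
  measurability proofs for integrands such as \<open>y \<mapsto> \<mu> (y - x)\<close> with \<open>\<mu>\<close> only Lebesgue measurable.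
\<close>

lemma borel_measurable_complete_AE:
  fixes f g :: "'a \<Rightarrow> real"
  assumes "AE x in completion M. f x = g x" "g \<in> borel_measurable (completion M)"
  shows "f \<in> borel_measurable (completion M)"
  unfolding borel_measurable_iff_le
proof
  fix a
  show "{w \<in> space (completion M). f w \<le> a} \<in> sets (completion M)"
  proof (rule completion.in_sets_AE)
    show "{w \<in> space (completion M). g w \<le> a} \<in> sets (completion M)"
      using assms(2) by measurable
    show "AE x in completion M. (x \<in> {w \<in> space (completion M). g w \<le> a}) = (x \<in> {w \<in> space (completion M). f w \<le> a})"
      using assms(1) by eventually_elim auto
  qed auto
qed

text \<open>
  The bridge from integrals over Lebesgue measure on a set to integrals of Borel functions over the
  whole space, where product measures are available.
\<close>

lemma integral_lebesgue_on_eq_lborel: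
  fixes f g :: "'a::euclidean_space \<Rightarrow> real"
  assumes S: "S \<in> sets borel" and g: "g \<in> borel_measurable borel"
    and ae: "AE x in lborel. indicator S x * f x = g x"
  shows "(\<integral>x. f x \<partial>lebesgue_on S) = (\<integral>x. g x \<partial>lborel)"
proof -
  have S': "S \<in> sets lebesgue" using S by simp
  have ae': "AE x in lebesgue. indicator S x * f x = g x" using ae by (rule AE_completion)
  have g': "g \<in> borel_measurable lebesgue" using g by (simp add: measurable_completion)
  have "(\<integral>x. f x \<partial>lebesgue_on S) = (\<integral>x. indicator S x * f x \<partial>lebesgue)"
    using S' by (subst integral_restrict_space) auto
  also have "\<dots> = (\<integral>x. g x \<partial>lebesgue)"
    by (intro integral_cong_AE borel_measurable_complete_AE[OF ae' g'] g' ae')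
  also have "\<dots> = (\<integral>x. g x \<partial>lborel)"
    using g by (intro integral_completion) simp
  finally show ?thesis .
qed

text \<open>
  By completeness either both functions are measurable or neither is, and in the second case both
  integrals are zero by convention.
\<close>

lemma integral_lebesgue_on_cong_AE:
  fixes f g :: "'a::euclidean_space \<Rightarrow> real"
  assumes S: "S \<in> sets lebesgue" and ae: "AE x in lborel. x \<in> S \<longrightarrow> f x = g x"
  shows "(\<integral>x. f x \<partial>lebesgue_on S) = (\<integral>x. g x \<partial>lebesgue_on S)"
proof -
  let ?f = "\<lambda>x. indicator S x * f x" and ?g = "\<lambda>x. indicator S x * g x"
  have fg: "AE x in lebesgue. ?f x = ?g x" using AE_completion[OF ae] by eventually_elim auto
  then have gf: "AE x in lebesgue. ?g x = ?f x" by eventually_elim (rule sym)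
  have "integral\<^sup>L lebesgue ?f = integral\<^sup>L lebesgue ?g"
  proof (cases "?g \<in> borel_measurable lebesgue")
    case True
    then show ?thesis by (intro integral_cong_AE borel_measurable_complete_AE[OF fg True] fg)
  next
    case False
    then have "?f \<notin> borel_measurable lebesgue" using borel_measurable_complete_AE[OF gf] by blast
    then show ?thesis using False by (metis borel_measurable_integrable not_integrable_integral_eq)
  qed
  then show ?thesis using S by (simp add: integral_restrict_space)
qed

lemma borel_representative:
  fixes f :: "'a::euclidean_space \<Rightarrow> real"
  assumes S: "S \<in> sets borel" and f: "f \<in> borel_measurable (lebesgue_on S)"
  shows "\<exists>g. g \<in> borel_measurable borel \<and> (\<forall>x. x \<notin> S \<longrightarrow> g x = 0) \<and> (AE x in lborel. x \<in> S \<longrightarrow> f x = g x)"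
proof -
  have "(\<lambda>x. indicator S x *\<^sub>R f x) \<in> borel_measurable lebesgue"
    using f S by (subst (asm) borel_measurable_restrict_space_iff) auto
  from completion_ex_borel_measurable_real[OF this]
  obtain h where h: "h \<in> borel_measurable borel" "AE x in lborel. indicator S x *\<^sub>R f x = h x"
    by auto
  let ?g = "\<lambda>x. indicator S x * h x"
  have "?g \<in> borel_measurable borel" using S h(1) by measurable
  moreover have "AE x in lborel. x \<in> S \<longrightarrow> f x = ?g x" using h(2) by eventually_elim auto
  ultimately show ?thesis by (intro exI[of _ ?g]) auto
qed

text \<open>
  The complement of the essential support is a union of possibly uncountably many open sets on each
  of which the function vanishes almost everywhere; by Lindelof's theorem countably many of them
  suffice, and a countable union of null sets is null.
\<close>

lemma AE_zero_outside_ess_supp: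
  fixes f :: "'a::euclidean_space \<Rightarrow> 'b::zero"
  shows "AE x in lborel. x \<notin> ess_supp f \<longrightarrow> f x = 0"
proof -
  let ?F = "{U. open U \<and> (AE x in lebesgue. x \<in> U \<longrightarrow> f x = 0)}"
  obtain F' where F': "F' \<subseteq> ?F" "countable F'" "\<Union>F' = \<Union>?F"
    using Lindelof[of ?F] by auto
  have "AE x in lebesgue. \<forall>U\<in>F'. x \<in> U \<longrightarrow> f x = 0"
    using F' by (subst AE_ball_countable) auto
  then have "AE x in lborel. \<forall>U\<in>F'. x \<in> U \<longrightarrow> f x = 0" by (simp add: AE_completion_iff)
  then show ?thesis
  proof eventually_elim
    case (elim x)
    show ?case
    proof
      assume "x \<notin> ess_supp f"
      then have "x \<in> \<Union>F'" unfolding F'(3) ess_supp_def by blast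
      then show "f x = 0" using elim by blast
    qed
  qed
qed

text \<open>
  The representative vanishes outside the open ball although the support is only known to lie in the
  closed one: the sphere is a null set. With such a kernel the cut-off \<open>\<chi>\<close> of the ball in the nonlocal
  derivative is absorbed in the kernel.
\<close>

lemma kernel_representative:
  fixes \<mu> :: "'a::euclidean_space \<Rightarrow> real ^ 'd"
  assumes int: "\<And>k. integrable lebesgue (\<lambda>z. \<mu> z $ k)" and supp: "ess_supp \<mu> \<subseteq> cball 0 \<delta>"
  shows "\<exists>m. m \<in> borel_measurable borel \<and> integrable lborel m \<and> (\<forall>z. \<delta> \<le> norm z \<longrightarrow> m z = 0)
    \<and> (AE z in lborel. \<mu> z $ k = m z)"
proof -
  have "(\<lambda>z. \<mu> z $ k) \<in> borel_measurable lebesgue" using int by blast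
  from completion_ex_borel_measurable_real[OF this]
  obtain h where h: "h \<in> borel_measurable borel" "AE z in lborel. \<mu> z $ k = h z" by auto
  let ?m = "\<lambda>z. indicator (ball 0 \<delta>) z * h z"
  have m: "?m \<in> borel_measurable borel"
    by (intro borel_measurable_times borel_measurable_indicator h(1)) simp
  have "sphere (0::'a) \<delta> \<in> null_sets lborel"
    using negligible_sphere[of "0::'a" \<delta>] null_sets_completion_iff[of "sphere (0::'a) \<delta>" lborel]
    unfolding negligible_iff_null_sets by simp
  then have "AE z in lborel. z \<notin> sphere (0::'a) \<delta>" by (rule AE_not_in)
  with AE_zero_outside_ess_supp[of \<mu>] h(2)
  have ae: "AE z in lborel. \<mu> z $ k = ?m z"
  proof eventually_elim
    case (elim z)
    show ?case
    proof (cases "norm z < \<delta>")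
      case False
      then have "z \<notin> ess_supp \<mu>" using elim supp by auto
      then show ?thesis using elim False by auto
    qed (use elim in auto)
  qed
  have "integrable lebesgue ?m"
  proof (rule integrable_cong_AE_imp[OF int[of k]])
    show "?m \<in> borel_measurable lebesgue" using m by (intro measurable_completion) simp
    show "AE z in lebesgue. \<mu> z $ k = ?m z" using ae by (rule AE_completion)
  qed
  then have "integrable lborel ?m" using m by (subst (asm) integrable_completion) simp_all
  then show ?thesis using m ae by (intro exI[of _ ?m]) auto
qed

section \<open>Integrability on the product space\<close>

lemma integrable_convolution_left:
  fixes a m :: "'a::euclidean_space \<Rightarrow> real"
  assumes a: "integrable lborel a" and m: "integrable lborel m"
  shows "integrable (lborel \<Otimes>\<^sub>M lborel) (\<lambda>(x, y). a x * m (y - x))"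
proof (rule lborel_pair.Fubini_integrable)
  have [measurable]: "a \<in> borel_measurable borel" "m \<in> borel_measurable borel" using a m by auto
  show "(\<lambda>(x, y). a x * m (y - x)) \<in> borel_measurable (lborel \<Otimes>\<^sub>M lborel)" by measurable
  have "(\<integral>y. norm (case (x, y) of (x, y) \<Rightarrow> a x * m (y - x)) \<partial>lborel) = \<bar>a x\<bar> * (\<integral>y. \<bar>m y\<bar> \<partial>lborel)" for x
    using integral_lborel_shift(1)[of "\<lambda>z. \<bar>m z\<bar>" x] by (simp add: abs_mult)
  then show "integrable lborel (\<lambda>x. \<integral>y. norm (case (x, y) of (x, y) \<Rightarrow> a x * m (y - x)) \<partial>lborel)"
    using a by simp
  show "AE x in lborel. integrable lborel (\<lambda>y. case (x, y) of (x, y) \<Rightarrow> a x * m (y - x))"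
    using integrable_lborel_shift(1)[OF m] by auto
qed

lemma integrable_convolution_right:
  fixes a m :: "'a::euclidean_space \<Rightarrow> real"
  assumes a: "integrable lborel a" and m: "integrable lborel m"
  shows "integrable (lborel \<Otimes>\<^sub>M lborel) (\<lambda>(x, y). a y * m (y - x))"
proof -
  have "integrable lborel (\<lambda>z. m (- z))" using integrable_lborel_shift(2)[OF m, of 0] by simp
  from lborel_pair.integrable_product_swap[OF integrable_convolution_left[OF a this]]
  show ?thesis by simp
qed

text \<open>
  Absolute integrability of all products below: a factor bounded by a sum of integrable functions of
  one variable each is reduced to the two convolution lemmas.
\<close>

lemma integrable_dominated_times_kernel:
  fixes a b m :: "'a::euclidean_space \<Rightarrow> real"
  assumes a: "integrable lborel a" and b: "integrable lborel b" and m: "integrable lborel m"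
    and h: "(\<lambda>(x, y). h x y) \<in> borel_measurable (lborel \<Otimes>\<^sub>M lborel)"
    and le: "\<And>x y. \<bar>h x y\<bar> \<le> a x + b y"
  shows "integrable (lborel \<Otimes>\<^sub>M lborel) (\<lambda>(x, y). h x y * m (y - x))"
    and "integrable (lborel \<Otimes>\<^sub>M lborel) (\<lambda>(x, y). h x y * m (x - y))"
proof -
  have *: "integrable (lborel \<Otimes>\<^sub>M lborel) (\<lambda>(x, y). h x y * k (y - x))" if k: "integrable lborel k" for k
  proof (rule Bochner_Integration.integrable_bound)
    have k': "integrable lborel (\<lambda>z. \<bar>k z\<bar>)" using k by simp
    show "integrable (lborel \<Otimes>\<^sub>M lborel) (\<lambda>p. (\<lambda>(x, y). a x * \<bar>k (y - x)\<bar>) p + (\<lambda>(x, y). b y * \<bar>k (y - x)\<bar>) p)"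
      by (intro Bochner_Integration.integrable_add integrable_convolution_left[OF a k'] integrable_convolution_right[OF b k'])
    have [measurable]: "k \<in> borel_measurable borel" using k by auto
    note h[measurable]
    show "(\<lambda>(x, y). h x y * k (y - x)) \<in> borel_measurable (lborel \<Otimes>\<^sub>M lborel)" by measurable
    show "AE p in lborel \<Otimes>\<^sub>M lborel. norm (case p of (x, y) \<Rightarrow> h x y * k (y - x))
        \<le> norm ((\<lambda>(x, y). a x * \<bar>k (y - x)\<bar>) p + (\<lambda>(x, y). b y * \<bar>k (y - x)\<bar>) p)"
    proof (rule AE_I2, clarsimp simp: abs_mult)
      fix x y
      have "\<bar>h x y\<bar> * \<bar>k (y - x)\<bar> \<le> (a x + b y) * \<bar>k (y - x)\<bar>" using le by (intro mult_right_mono) auto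
      then show "\<bar>h x y\<bar> * \<bar>k (y - x)\<bar> \<le> \<bar>a x * \<bar>k (y - x)\<bar> + b y * \<bar>k (y - x)\<bar>\<bar>"
        by (simp add: algebra_simps)
    qed
  qed
  show "integrable (lborel \<Otimes>\<^sub>M lborel) (\<lambda>(x, y). h x y * m (y - x))" using *[OF m] .
  have "integrable lborel (\<lambda>z. m (- z))" using integrable_lborel_shift(2)[OF m, of 0] by simp
  from *[OF this] show "integrable (lborel \<Otimes>\<^sub>M lborel) (\<lambda>(x, y). h x y * m (x - y))" by simp
qed

section \<open>Geometry of the collars\<close>

lemma nl_domain_eq:
  assumes "\<delta> \<ge> 0" shows "nl_domain \<Omega> \<delta> = (\<Union>x\<in>\<Omega>. cball x \<delta>)"
  using assms unfolding nl_domain_def collar_def by auto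

text \<open>
  Although it is a union of closed balls, the extended domain is also the union of the translates of the
  open set \<open>\<Omega>\<close> by the vectors of the closed ball.
\<close>

lemma open_nl_domain:
  fixes \<Omega> :: "'a::real_normed_vector set"
  assumes "open \<Omega>" "\<delta> \<ge> 0"
  shows "open (nl_domain \<Omega> \<delta>)"
proof -
  have "(\<Union>x\<in>\<Omega>. cball x \<delta>) = (\<Union>z\<in>cball 0 \<delta>. (+) z ` \<Omega>)"
  proof (intro equalityI subsetI)
    fix y assume "y \<in> (\<Union>x\<in>\<Omega>. cball x \<delta>)"
    then obtain x where "x \<in> \<Omega>" "dist x y \<le> \<delta>" by auto
    then show "y \<in> (\<Union>z\<in>cball 0 \<delta>. (+) z ` \<Omega>)"
      by (intro UN_I[of "y - x"] image_eqI[of _ _ x]) (auto simp: dist_norm norm_minus_commute)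
  next
    fix y assume "y \<in> (\<Union>z\<in>cball 0 \<delta>. (+) z ` \<Omega>)"
    then obtain z x where "norm z \<le> \<delta>" "x \<in> \<Omega>" "y = z + x" by auto
    then show "y \<in> (\<Union>x\<in>\<Omega>. cball x \<delta>)" by (intro UN_I[of x]) (auto simp: dist_norm)
  qed
  then show ?thesis using assms by (auto simp: nl_domain_eq intro: open_translation)
qed

lemma bounded_nl_domain:
  fixes \<Omega> :: "'a::real_normed_vector set"
  assumes "bounded \<Omega>" "\<delta> \<ge> 0"
  shows "bounded (nl_domain \<Omega> \<delta>)"
proof -
  obtain r where r: "\<And>x. x \<in> \<Omega> \<Longrightarrow> norm x \<le> r" using assms(1) by (auto simp: bounded_iff)
  have "norm y \<le> r + \<delta>" if "y \<in> nl_domain \<Omega> \<delta>" for y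
  proof -
    from that obtain x where x: "x \<in> \<Omega>" "dist x y \<le> \<delta>" using assms(2) by (auto simp: nl_domain_eq)
    have "norm y \<le> norm x + norm (y - x)" by (metis norm_triangle_sub)
    then show ?thesis using r[OF x(1)] x(2) by (simp add: dist_norm norm_minus_commute)
  qed
  then show ?thesis by (auto simp: bounded_iff)
qed

text \<open>
  The segment from a point inside to a point outside meets the boundary. Consequently a kernel supported
  in a ball of radius \<open>\<delta>\<close> couples the collar only to points of the inner collar.
\<close>

lemma inner_collarI:
  fixes \<Omega> :: "'a::euclidean_space set"
  assumes "x \<in> \<Omega>" "y \<notin> \<Omega>" "dist x y \<le> \<delta>"
  shows "x \<in> inner_collar \<Omega> \<delta>"
proof -
  have "closed_segment x y \<inter> frontier \<Omega> \<noteq> {}"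
    by (rule connected_Int_frontier) (use assms ends_in_segment in blast)+
  then obtain w where w: "w \<in> closed_segment x y" "w \<in> frontier \<Omega>" by auto
  have "infdist x (frontier \<Omega>) \<le> dist x w" by (rule infdist_le[OF w(2)])
  also have "\<dots> \<le> dist x y" using dist_in_closed_segment[OF w(1)] by (simp add: dist_commute)
  finally show ?thesis using assms by (simp add: inner_collar_def)
qed

lemma inner_collar_borel:
  fixes \<Omega> :: "'a::euclidean_space set"
  assumes "open \<Omega>"
  shows "inner_collar \<Omega> \<delta> \<in> sets borel"
proof -
  have "closed {x. infdist x (frontier \<Omega>) \<le> \<delta>}"
    by (intro closed_Collect_le continuous_intros)
  then have "\<Omega> \<inter> {x. infdist x (frontier \<Omega>) \<le> \<delta>} \<in> sets borel" using assms by simp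
  then show ?thesis by (simp add: inner_collar_def Collect_conj_eq)
qed

section \<open>Domination for conjugate exponents\<close>

lemma conjugate_exponents_real:
  fixes p p' :: ennreal
  assumes "1 < p" "p < \<infinity>" "1 / p + 1 / p' = 1"
  shows "enn2real p > 1" "enn2real p' > 1" "p' \<noteq> \<infinity>" "1 / enn2real p + 1 / enn2real p' = 1"
proof -
  define P where "P = enn2real p"
  have p: "p = ennreal P" "P \<ge> 0" using assms by (auto simp: P_def)
  have P: "P > 1" using assms(1) p ennreal_less_iff[of 1 P] by simp
  have ip: "1 / p = ennreal (1 / P)" using P p by (simp add: divide_ennreal flip: ennreal_1)
  have ne: "p' \<noteq> \<infinity>"
  proof
    assume "p' = \<infinity>"
    then have "ennreal (1 / P) = ennreal 1" using assms(3) ip by simp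
    then show False using P by (subst (asm) ennreal_inj) auto
  qed
  define Q where "Q = enn2real p'"
  have q: "p' = ennreal Q" "Q \<ge> 0" using ne by (auto simp: Q_def less_top)
  have Q0: "Q > 0"
  proof (rule ccontr)
    assume "\<not> Q > 0"
    then have "p' = 0" using q by simp
    then have "1 / p' = \<infinity>" by (simp add: ennreal_divide_zero)
    then show False using assms(3) by simp
  qed
  have "1 / p' = ennreal (1 / Q)" using Q0 q by (simp add: divide_ennreal flip: ennreal_1)
  then have "ennreal (1 / P + 1 / Q) = ennreal 1" using assms(3) ip P Q0 by (simp add: ennreal_plus)
  then have PQ: "1 / P + 1 / Q = 1" using P Q0 by (subst (asm) ennreal_inj) auto
  moreover have "Q > 1"
  proof (rule ccontr)
    assume "\<not> Q > 1"
    then have "1 / Q \<ge> 1" using Q0 by simp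
    moreover have "1 / P > 0" using P by simp
    ultimately show False using PQ by linarith
  qed
  ultimately show "enn2real p > 1" "enn2real p' > 1" "p' \<noteq> \<infinity>" "1 / enn2real p + 1 / enn2real p' = 1"
    using P ne by (auto simp: P_def Q_def)
qed

lemma Lq_representative_powr_integrable:
  fixes u u' :: "'a::euclidean_space \<Rightarrow> real"
  assumes S: "S \<in> sets borel" and u: "u \<in> Lq q S" and q: "q \<noteq> \<infinity>"
    and u': "u' \<in> borel_measurable borel" "\<And>x. x \<notin> S \<Longrightarrow> u' x = 0"
    and ae: "AE x in lborel. x \<in> S \<longrightarrow> u x = u' x"
  shows "integrable lborel (\<lambda>x. \<bar>u' x\<bar> powr enn2real q)"
proof -
  let ?g = "\<lambda>x. \<bar>u' x\<bar> powr enn2real q"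
  have g: "?g \<in> borel_measurable borel" using u'(1) by measurable
  have "integrable (lebesgue_on S) (\<lambda>x. \<bar>u x\<bar> powr enn2real q)" using u q by (simp add: Lq_def)
  then have i: "integrable lebesgue (\<lambda>x. indicator S x *\<^sub>R (\<bar>u x\<bar> powr enn2real q))"
    using S by (subst (asm) integrable_restrict_space) (auto simp: set_integrable_def)
  have "integrable lebesgue ?g"
  proof (rule integrable_cong_AE_imp[OF i])
    show "?g \<in> borel_measurable lebesgue" using g by (intro measurable_completion) simp
    show "AE x in lebesgue. indicator S x *\<^sub>R (\<bar>u x\<bar> powr enn2real q) = ?g x"
      using AE_completion[OF ae] by eventually_elim (use u'(2) in \<open>auto simp: indicator_def\<close>)
  qed
  then show ?thesis using g by (subst (asm) integrable_completion) simp_all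
qed

text \<open>
  What is left of the duality of \<open>L\<^sup>p\<close> and \<open>L\<^bsup>p'\<^esup>\<close>. Since the bound holds for two independent points, it
  covers \<open>u(x) v(y)\<close>, \<open>u(y) v(x)\<close> and, on the diagonal, \<open>u(x) v(x)\<close> alike, and it treats all exponents
  uniformly.
\<close>

locale dominated_pair =
  fixes u v a b :: "'a::euclidean_space \<Rightarrow> real"
  assumes u_borel [measurable]: "u \<in> borel_measurable borel"
    and v_borel [measurable]: "v \<in> borel_measurable borel"
    and a_int: "integrable lborel a" and b_int: "integrable lborel b"
    and dom: "\<And>x y. \<bar>u x * v y\<bar> \<le> a x + b y"
text \<open>
  For \<open>p > 1\<close> this is Young's inequality with \<open>a = \<bar>u\<bar>\<^sup>p / p\<close>. For \<open>p = 1\<close> the representative of \<open>v\<close> is cut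
  off at an essential bound \<open>c\<close>, so that it is bounded everywhere, and \<open>a = c \<bar>u\<bar>\<close>, \<open>b = 0\<close>. The
  representative of \<open>u\<close> is prescribed because one choice has to serve every component of a vector field.
\<close>

lemma dual_pair_dominated:
  fixes u u' v :: "'a::euclidean_space \<Rightarrow> real"
  assumes S: "S \<in> sets borel" and p: "1 \<le> p" "p < \<infinity>" "1 / p + 1 / p' = 1"
    and u: "u \<in> Lq p S" and v: "v \<in> Lq p' S"
    and u': "u' \<in> borel_measurable borel" "\<And>x. x \<notin> S \<Longrightarrow> u' x = 0"
    and ae: "AE x in lborel. x \<in> S \<longrightarrow> u x = u' x"
  shows "\<exists>v' a b. dominated_pair u' v' a b \<and> (AE x in lborel. x \<in> S \<longrightarrow> v x = v' x)"
proof -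
  have iu: "integrable lborel (\<lambda>x. \<bar>u' x\<bar> powr enn2real p)"
    using Lq_representative_powr_integrable[OF S u _ u' ae] p(2) by simp
  have "v \<in> borel_measurable (lebesgue_on S)" using v by (simp add: Lq_def)
  from borel_representative[OF S this] obtain v0 where v0: "v0 \<in> borel_measurable borel"
    "\<And>x. x \<notin> S \<Longrightarrow> v0 x = 0" "AE x in lborel. x \<in> S \<longrightarrow> v x = v0 x" by auto
  show ?thesis
  proof (cases "p = 1")
    case True
    then have "1 / p' = 0" using p(3) by simp
    then have "p' = \<infinity>" by (simp add: ennreal_divide_eq_0_iff)
    then have "esssup (lebesgue_on S) (\<lambda>x. ereal \<bar>v x\<bar>) < \<infinity>" using v by (simp add: Lq_def)
    then obtain n where n: "esssup (lebesgue_on S) (\<lambda>x. ereal \<bar>v x\<bar>) < ereal (real n)"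
      using less_PInf_Ex_of_nat by auto
    define c where "c = real n"
    have "AE x in lebesgue_on S. \<bar>v x\<bar> \<le> c"
      using esssup_AE[of "\<lambda>x. ereal \<bar>v x\<bar>" "lebesgue_on S"]
    proof eventually_elim
      case (elim x)
      then have "ereal \<bar>v x\<bar> < ereal (real n)" using n by (rule le_less_trans)
      then show ?case by (simp add: c_def)
    qed
    then have "AE x in lebesgue. x \<in> S \<longrightarrow> \<bar>v x\<bar> \<le> c" using S by (simp add: AE_restrict_space_iff)
    then have bd: "AE x in lborel. x \<in> S \<longrightarrow> \<bar>v x\<bar> \<le> c" by (simp add: AE_completion_iff)
    define v' where "v' x = max (- c) (min c (v0 x))" for x
    have "v' \<in> borel_measurable borel" unfolding v'_def using v0(1) by measurable
    moreover have "AE x in lborel. x \<in> S \<longrightarrow> v x = v' x"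
      using bd v0(3) by eventually_elim (auto simp: v'_def)
    moreover have "integrable lborel (\<lambda>x. c * \<bar>u' x\<bar>)" using iu True by simp
    moreover have "integrable lborel (\<lambda>x. 0)" by simp
    moreover have "\<bar>u' x * v' y\<bar> \<le> c * \<bar>u' x\<bar> + 0" for x y
    proof -
      have "\<bar>v' y\<bar> \<le> c" by (auto simp: v'_def c_def)
      then have "\<bar>u' x\<bar> * \<bar>v' y\<bar> \<le> \<bar>u' x\<bar> * c" by (intro mult_left_mono) auto
      then show ?thesis by (simp add: abs_mult mult.commute)
    qed
    ultimately show ?thesis using u'(1)
      by (intro exI[of _ v'] exI[of _ "\<lambda>x. c * \<bar>u' x\<bar>"] exI[of _ "\<lambda>x. 0"]) (simp add: dominated_pair_def)
  next
    case False
    then have "1 < p" using p(1) by simp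
    note e = conjugate_exponents_real[OF this p(2,3)]
    let ?P = "enn2real p" and ?Q = "enn2real p'"
    have iv: "integrable lborel (\<lambda>x. \<bar>v0 x\<bar> powr ?Q)"
      using Lq_representative_powr_integrable[OF S v e(3) v0] .
    have "\<bar>u' x * v0 y\<bar> \<le> \<bar>u' x\<bar> powr ?P / ?P + \<bar>v0 y\<bar> powr ?Q / ?Q" for x y
      using Youngs_inequality[OF e(1,2,4), of "\<bar>u' x\<bar>" "\<bar>v0 y\<bar>"] by (simp add: abs_mult)
    then show ?thesis using u'(1) v0 iu iv
      by (intro exI[of _ v0] exI[of _ "\<lambda>x. \<bar>u' x\<bar> powr ?P / ?P"] exI[of _ "\<lambda>x. \<bar>v0 x\<bar> powr ?Q / ?Q"])
         (simp add: dominated_pair_def)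
  qed
qed

section \<open>The scalar identity\<close>

definition even_part :: "('a::euclidean_space \<Rightarrow> real) \<Rightarrow> 'a \<Rightarrow> real" where
  "even_part m z = (m z + m (- z)) / 2"

text \<open>
  The double integral of this density is the pairing of \<open>g\<close> with the nonlocal derivative of \<open>f\<close>.
\<close>

definition deriv_density ::
    "'a::euclidean_space set \<Rightarrow> 'a set \<Rightarrow> ('a \<Rightarrow> real) \<Rightarrow> ('a \<Rightarrow> real) \<Rightarrow> ('a \<Rightarrow> real) \<Rightarrow> 'a \<Rightarrow> 'a \<Rightarrow> real" where
  "deriv_density \<Omega> W m f g x y = indicator \<Omega> x * indicator W y * ((f y - f x) * g x * m (y - x))"

text \<open>
  One component of the integrand of the collar term of \<open>A\<close>, with \<open>\<Omega>\<close> in place of the inner collar.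
\<close>

definition collar_density ::
    "'a::euclidean_space set \<Rightarrow> 'a set \<Rightarrow> ('a \<Rightarrow> real) \<Rightarrow> ('a \<Rightarrow> real) \<Rightarrow> ('a \<Rightarrow> real) \<Rightarrow> 'a \<Rightarrow> 'a \<Rightarrow> real" where
  "collar_density \<Omega> W m u v x y = indicator \<Omega> x * indicator (W - \<Omega>) y *
     ((u y * v x + u x * v y) * m (y - x) - 2 * u x * v y * even_part m (y - x))"

lemma integrable_even_part: "integrable lborel m \<Longrightarrow> integrable lborel (even_part m)"
  unfolding even_part_def using integrable_lborel_shift(2)[of m 0] by auto

context dominated_pair
begin

lemma indicator_dom:
  assumes "\<bar>t\<bar> \<le> s" shows "\<bar>indicator A x * indicator B y * t\<bar> \<le> (s::real)"
  using assms by (auto simp: indicator_def)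

lemma integrable_products:
  assumes A [measurable]: "A \<in> sets borel" and B [measurable]: "B \<in> sets borel" and k: "integrable lborel k"
  shows "integrable (lborel \<Otimes>\<^sub>M lborel) (\<lambda>(x, y). indicator A x * indicator B y * (u x * v y) * k (y - x))"
    and "integrable (lborel \<Otimes>\<^sub>M lborel) (\<lambda>(x, y). indicator A x * indicator B y * (u y * v x) * k (y - x))"
    and "integrable (lborel \<Otimes>\<^sub>M lborel) (\<lambda>(x, y). indicator A x * indicator B y * (u x * v x) * k (y - x))"
    and "integrable (lborel \<Otimes>\<^sub>M lborel) (\<lambda>(x, y). indicator A x * indicator B y * (u x * v y) * k (x - y))"
    and "integrable (lborel \<Otimes>\<^sub>M lborel) (\<lambda>(x, y). indicator A x * indicator B y * (u x * v x) * k (x - y))"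
proof -
  have ab: "integrable lborel (\<lambda>x. a x + b x)" and z: "integrable lborel (\<lambda>x::'a. 0::real)"
    using a_int b_int by auto
  have m: "(\<lambda>(x, y). indicator A x * indicator B y * (u x * v y)) \<in> borel_measurable (lborel \<Otimes>\<^sub>M lborel)"
    "(\<lambda>(x, y). indicator A x * indicator B y * (u y * v x)) \<in> borel_measurable (lborel \<Otimes>\<^sub>M lborel)"
    "(\<lambda>(x, y). indicator A x * indicator B y * (u x * v x)) \<in> borel_measurable (lborel \<Otimes>\<^sub>M lborel)"
    by measurable
  have xy: "\<bar>indicator A x * indicator B y * (u x * v y)\<bar> \<le> a x + b y"
    and yx: "\<bar>indicator A x * indicator B y * (u y * v x)\<bar> \<le> b x + a y"
    and xx: "\<bar>indicator A x * indicator B y * (u x * v x)\<bar> \<le> (a x + b x) + 0" for x y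
    using dom[of x y] dom[of y x] dom[of x x] by (auto intro!: indicator_dom)
  note i1 = integrable_dominated_times_kernel[OF a_int b_int k m(1) xy]
  note i2 = integrable_dominated_times_kernel[OF b_int a_int k m(2) yx]
  note i3 = integrable_dominated_times_kernel[OF ab z k m(3) xx]
  show "integrable (lborel \<Otimes>\<^sub>M lborel) (\<lambda>(x, y). indicator A x * indicator B y * (u x * v y) * k (y - x))" by (rule i1(1))
  show "integrable (lborel \<Otimes>\<^sub>M lborel) (\<lambda>(x, y). indicator A x * indicator B y * (u y * v x) * k (y - x))" by (rule i2(1))
  show "integrable (lborel \<Otimes>\<^sub>M lborel) (\<lambda>(x, y). indicator A x * indicator B y * (u x * v x) * k (y - x))" by (rule i3(1))
  show "integrable (lborel \<Otimes>\<^sub>M lborel) (\<lambda>(x, y). indicator A x * indicator B y * (u x * v y) * k (x - y))" by (rule i1(2))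
  show "integrable (lborel \<Otimes>\<^sub>M lborel) (\<lambda>(x, y). indicator A x * indicator B y * (u x * v x) * k (x - y))" by (rule i3(2))
qed

lemma integrable_deriv_density:
  assumes "\<Omega> \<in> sets borel" "W \<in> sets borel" "integrable lborel k"
  shows "integrable (lborel \<Otimes>\<^sub>M lborel) (case_prod (deriv_density \<Omega> W k u v))"
    and "integrable (lborel \<Otimes>\<^sub>M lborel) (case_prod (deriv_density \<Omega> W k v u))"
proof -
  note i = integrable_products[OF assms]
  from Bochner_Integration.integrable_diff[OF i(2) i(3)]
  show "integrable (lborel \<Otimes>\<^sub>M lborel) (case_prod (deriv_density \<Omega> W k u v))"
    by (rule back_subst[of "integrable _"]) (auto simp: fun_eq_iff deriv_density_def algebra_simps)
  from Bochner_Integration.integrable_diff[OF i(1) i(3)]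
  show "integrable (lborel \<Otimes>\<^sub>M lborel) (case_prod (deriv_density \<Omega> W k v u))"
    by (rule back_subst[of "integrable _"]) (auto simp: fun_eq_iff deriv_density_def algebra_simps)
qed

lemma integrable_collar_density:
  assumes "\<Omega> \<in> sets borel" "W \<in> sets borel" "integrable lborel k"
  shows "integrable (lborel \<Otimes>\<^sub>M lborel) (case_prod (collar_density \<Omega> W k u v))"
proof -
  have G: "W - \<Omega> \<in> sets borel" using assms by auto
  note i = integrable_products[OF assms(1) G assms(3)]
  note e = integrable_products(1)[OF assms(1) G integrable_even_part[OF assms(3)]]
  from Bochner_Integration.integrable_diff[OF Bochner_Integration.integrable_add[OF i(2) i(1)]
      integrable_mult_right[OF e, of 2]]
  show ?thesis
    by (rule back_subst[of "integrable _"]) (auto simp: fun_eq_iff collar_density_def algebra_simps)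
qed

text \<open>
  In the difference of the two sides, the terms with \<open>u\<close> and \<open>v\<close> at different points cancel pointwise on
  \<open>\<Omega> \<times> (W - \<Omega>)\<close> and by exchanging \<open>x\<close> and \<open>y\<close> on \<open>\<Omega> \<times> \<Omega>\<close>. The
  remaining terms carry \<open>u(x) v(x)\<close>; there the kernel sees the whole space from every \<open>x \<in> \<Omega>\<close>, and
  \<open>m\<close> and its reflection have the same total integral.
\<close>

lemma integral_deriv_density_by_parts:
  assumes \<Omega>: "\<Omega> \<in> sets borel" and W: "W \<in> sets borel" and sub: "\<Omega> \<subseteq> W"
    and ball: "\<And>x. x \<in> \<Omega> \<Longrightarrow> ball x \<delta> \<subseteq> W"
    and m: "integrable lborel m" and supp: "\<And>z. \<delta> \<le> norm z \<Longrightarrow> m z = 0"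
  shows "(\<integral>p. case_prod (deriv_density \<Omega> W m u v) p \<partial>(lborel \<Otimes>\<^sub>M lborel))
       = - (\<integral>p. case_prod (deriv_density \<Omega> W m v u) p \<partial>(lborel \<Otimes>\<^sub>M lborel))
         + (\<integral>p. case_prod (collar_density \<Omega> W m u v) p \<partial>(lborel \<Otimes>\<^sub>M lborel))
         + 2 * (\<integral>p. case_prod (deriv_density \<Omega> W (even_part m) v u) p \<partial>(lborel \<Otimes>\<^sub>M lborel))"
proof -
  let ?M = "lborel \<Otimes>\<^sub>M lborel :: ('a \<times> 'a) measure"
  let ?L = "case_prod (deriv_density \<Omega> W m u v)" and ?D = "case_prod (deriv_density \<Omega> W m v u)"
  let ?C = "case_prod (collar_density \<Omega> W m u v)" and ?S = "case_prod (deriv_density \<Omega> W (even_part m) v u)"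
  \<comment> \<open>\<open>A - A'\<close> is antisymmetric under exchange of \<open>x\<close> and \<open>y\<close>; \<open>B - B'\<close> has vanishing inner integrals.\<close>
  let ?A = "\<lambda>(x, y). indicator \<Omega> x * indicator \<Omega> y * (u y * v x) * m (y - x)"
  let ?A' = "\<lambda>(x, y). indicator \<Omega> x * indicator \<Omega> y * (u x * v y) * m (x - y)"
  let ?B = "\<lambda>(x, y). indicator \<Omega> x * indicator W y * (u x * v x) * m (x - y)"
  let ?B' = "\<lambda>(x, y). indicator \<Omega> x * indicator W y * (u x * v x) * m (y - x)"
  have [measurable]: "m \<in> borel_measurable borel" using m by auto
  note i\<Omega> = integrable_products[OF \<Omega> \<Omega> m] and iW = integrable_products[OF \<Omega> W m]
  note iL = integrable_deriv_density(1)[OF \<Omega> W m] and iD = integrable_deriv_density(2)[OF \<Omega> W m]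
  note iC = integrable_collar_density[OF \<Omega> W m]
  note iS = integrable_deriv_density(2)[OF \<Omega> W integrable_even_part[OF m]]
  have "(\<lambda>p. ?L p + ?D p - ?C p - 2 * ?S p) = (\<lambda>p. (?A p - ?A' p) + (?B p - ?B' p))"
  proof (rule ext)
    fix p :: "'a \<times> 'a"
    obtain x y where "p = (x, y)" by fastforce
    then show "?L p + ?D p - ?C p - 2 * ?S p = (?A p - ?A' p) + (?B p - ?B' p)"
      using sub
      by (cases "x \<in> \<Omega>"; cases "y \<in> \<Omega>"; cases "y \<in> W")
         (auto simp: deriv_density_def collar_density_def even_part_def field_simps)
  qed
  moreover have "(\<integral>p. f p + g p - h p - 2 * k p \<partial>?M) = integral\<^sup>L ?M f + integral\<^sup>L ?M g - integral\<^sup>L ?M h - 2 * integral\<^sup>L ?M k"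
    and "(\<integral>p. (f p - g p) + (h p - k p) \<partial>?M) = (integral\<^sup>L ?M f - integral\<^sup>L ?M g) + (integral\<^sup>L ?M h - integral\<^sup>L ?M k)"
    if "integrable ?M f" "integrable ?M g" "integrable ?M h" "integrable ?M k" for f g h k :: "'a \<times> 'a \<Rightarrow> real"
    using that by simp_all
  note this(1)[OF iL iD iC iS] this(2)[OF i\<Omega>(2) i\<Omega>(4) iW(5) iW(3)]
  ultimately have eq: "integral\<^sup>L ?M ?L + integral\<^sup>L ?M ?D - integral\<^sup>L ?M ?C - 2 * integral\<^sup>L ?M ?S
      = (integral\<^sup>L ?M ?A - integral\<^sup>L ?M ?A') + (integral\<^sup>L ?M ?B - integral\<^sup>L ?M ?B')"
    by simp
  have "integral\<^sup>L ?M ?A' = integral\<^sup>L ?M ?A"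
    using lborel_pair.integral_product_swap[of ?A, OF borel_measurable_integrable[OF i\<Omega>(2)]]
    by (simp add: mult.commute mult.left_commute)
  moreover have "integral\<^sup>L ?M ?B = integral\<^sup>L ?M ?B'"
  proof -
    \<comment> \<open>Points \<open>y\<close> outside \<open>W\<close> are invisible from \<open>x \<in> \<Omega>\<close>, so the restriction to \<open>W\<close> can be dropped.\<close>
    have far: "m (x - y) = 0" "m (y - x) = 0" if "x \<in> \<Omega>" "y \<notin> W" for x y
    proof -
      have "y \<notin> ball x \<delta>" using ball that by blast
      then have "\<delta> \<le> norm (x - y)" by (simp add: dist_norm)
      then show "m (x - y) = 0" "m (y - x) = 0" by (simp_all add: supp norm_minus_commute)
    qed
    have "integral\<^sup>L ?M ?B = (\<integral>x. \<integral>y. indicator \<Omega> x * indicator W y * (u x * v x) * m (x - y) \<partial>lborel \<partial>lborel)"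
      using lborel_pair.integral_fst[OF iW(5)] by simp
    also have "\<dots> = (\<integral>x. indicator \<Omega> x * (u x * v x) * (\<integral>y. m y \<partial>lborel) \<partial>lborel)"
    proof (rule Bochner_Integration.integral_cong[OF refl])
      fix x
      have "indicator \<Omega> x * indicator W y * (u x * v x) * m (x - y) = indicator \<Omega> x * (u x * v x) * m (x - y)" for y
        using far[of x y] by (auto simp: indicator_def)
      then have "(\<integral>y. indicator \<Omega> x * indicator W y * (u x * v x) * m (x - y) \<partial>lborel)
          = (\<integral>y. indicator \<Omega> x * (u x * v x) * m (x - y) \<partial>lborel)"
        by (rule Bochner_Integration.integral_cong[OF refl])
      then show "(\<integral>y. indicator \<Omega> x * indicator W y * (u x * v x) * m (x - y) \<partial>lborel)
          = indicator \<Omega> x * (u x * v x) * (\<integral>y. m y \<partial>lborel)"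
        using integral_lborel_shift(2)[of m x] by simp
    qed
    also have "\<dots> = (\<integral>x. \<integral>y. indicator \<Omega> x * indicator W y * (u x * v x) * m (y - x) \<partial>lborel \<partial>lborel)"
    proof (rule Bochner_Integration.integral_cong[OF refl])
      fix x
      have "indicator \<Omega> x * indicator W y * (u x * v x) * m (y - x) = indicator \<Omega> x * (u x * v x) * m (y - x)" for y
        using far[of x y] by (auto simp: indicator_def)
      then have "(\<integral>y. indicator \<Omega> x * indicator W y * (u x * v x) * m (y - x) \<partial>lborel)
          = (\<integral>y. indicator \<Omega> x * (u x * v x) * m (y - x) \<partial>lborel)"
        by (rule Bochner_Integration.integral_cong[OF refl])
      then show "indicator \<Omega> x * (u x * v x) * (\<integral>y. m y \<partial>lborel)
          = (\<integral>y. indicator \<Omega> x * indicator W y * (u x * v x) * m (y - x) \<partial>lborel)"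
        using integral_lborel_shift(1)[of m x] by simp
    qed
    also have "\<dots> = integral\<^sup>L ?M ?B'"
      using lborel_pair.integral_fst[OF iW(3)] by simp
    finally show ?thesis .
  qed
  ultimately show ?thesis using eq by linarith
qed

end

section \<open>The identity for the nonlocal gradient and divergence\<close>

lemma even_part_eq_0: "(\<And>z. \<delta> \<le> norm z \<Longrightarrow> m z = 0) \<Longrightarrow> \<delta> \<le> norm z \<Longrightarrow> even_part m z = 0"
  by (simp add: even_part_def)

text \<open>
  The inner integral of the derivative depends on \<open>f\<close> only up to null sets in \<open>y\<close>, but also on the
  single value \<open>f x\<close>, so the equality holds only at those \<open>x\<close> where \<open>f\<close> and \<open>g\<close> agree with their representatives.
\<close>

lemma nl_deriv_times_AE:
  fixes \<Omega> :: "'a::euclidean_space set"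
  assumes \<Omega>: "open \<Omega>" and \<delta>: "\<delta> > 0"
    and [measurable]: "m \<in> borel_measurable borel" "f' \<in> borel_measurable borel"
    and supp: "\<forall>z. \<delta> \<le> norm z \<longrightarrow> m z = 0"
    and \<mu>: "AE z in lborel. \<mu> z = m z"
    and f: "AE x in lborel. x \<in> nl_domain \<Omega> \<delta> \<longrightarrow> f x = f' x"
    and g: "AE x in lborel. x \<in> nl_domain \<Omega> \<delta> \<longrightarrow> g x = g' x"
  shows "AE x in lborel. indicator (nl_domain \<Omega> \<delta>) x * (nl_deriv \<Omega> \<delta> \<mu> f x * g x)
      = (\<integral>y. deriv_density \<Omega> (nl_domain \<Omega> \<delta>) m f' g' x y \<partial>lborel)"
  using f g
proof eventually_elim
  case (elim x)
  let ?W = "nl_domain \<Omega> \<delta>"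
  have W [measurable]: "?W \<in> sets borel" using open_nl_domain[OF \<Omega>] \<delta> by simp
  show ?case
  proof (cases "x \<in> \<Omega>")
    case True
    then have xW: "x \<in> ?W" by (simp add: nl_domain_def)
    have "(\<integral>y. (f y - f x) * \<mu> (y - x) * indicator (ball x \<delta>) y \<partial>lebesgue_on ?W)
        = (\<integral>y. indicator ?W y * ((f' y - f' x) * m (y - x)) \<partial>lborel)"
    proof (rule integral_lebesgue_on_eq_lborel[OF W])
      show "(\<lambda>y. indicator ?W y * ((f' y - f' x) * m (y - x))) \<in> borel_measurable borel" by measurable
      show "AE y in lborel. indicator ?W y * ((f y - f x) * \<mu> (y - x) * indicator (ball x \<delta>) y)
          = indicator ?W y * ((f' y - f' x) * m (y - x))"
        using f AE_lborel_shift(1)[OF \<mu>, of x]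
      proof eventually_elim
        case (elim y)
        then show ?case
          using \<open>x \<in> ?W \<longrightarrow> f x = f' x\<close> xW supp[rule_format, of "y - x"]
          by (auto simp: indicator_def dist_norm norm_minus_commute)
      qed
    qed
    then have "indicator ?W x * (nl_deriv \<Omega> \<delta> \<mu> f x * g x)
        = g' x * (\<integral>y. indicator ?W y * ((f' y - f' x) * m (y - x)) \<partial>lborel)"
      using elim xW True by (simp add: nl_deriv_def)
    also have "\<dots> = (\<integral>y. g' x * (indicator ?W y * ((f' y - f' x) * m (y - x))) \<partial>lborel)"
      by simp
    finally show ?thesis using True by (simp add: deriv_density_def mult_ac)
  qed (simp add: nl_deriv_def deriv_density_def)
qed

lemma pairing_nl_deriv_eq_density:
  fixes \<Omega> :: "'a::euclidean_space set"
  assumes \<Omega>: "open \<Omega>" and \<delta>: "\<delta> > 0"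
    and ae: "AE x in lborel. indicator (nl_domain \<Omega> \<delta>) x * (nl_deriv \<Omega> \<delta> \<mu> f x * g x)
      = (\<integral>y. h x y \<partial>lborel)"
    and int: "integrable (lborel \<Otimes>\<^sub>M lborel) (case_prod h)"
  shows "pairing \<Omega> \<delta> (nl_deriv \<Omega> \<delta> \<mu> f) g = (\<integral>p. case_prod h p \<partial>(lborel \<Otimes>\<^sub>M lborel))"
proof -
  have W: "nl_domain \<Omega> \<delta> \<in> sets borel" using open_nl_domain[OF \<Omega>] \<delta> by simp
  have "(\<lambda>x. \<integral>y. h x y \<partial>lborel) \<in> borel_measurable borel"
    using borel_measurable_integrable[OF lborel_pair.integrable_fst[OF int]] by simp
  from integral_lebesgue_on_eq_lborel[OF W this ae] show ?thesis
    unfolding pairing_def using lborel_pair.integral_fst[OF int] by simp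
qed

text \<open>
  After passage to Borel representatives, with the same one of \<open>u\<close> for all components, each term becomes
  a sum over \<open>k\<close> of product integrals, and the scalar identity applies for each \<open>k\<close>.
\<close>

lemma nonlocal_green_identity:
  fixes \<Omega> :: "(real ^ 'd) set" and \<delta> :: real and \<mu> :: "real ^ 'd \<Rightarrow> real ^ 'd"
    and p p' :: ennreal
  assumes \<Omega>: "open \<Omega>" and \<delta>: "\<delta> > 0"
    and \<mu>: "\<And>k. integrable lebesgue (\<lambda>z. \<mu> z $ k)" "ess_supp \<mu> \<subseteq> cball 0 \<delta>"
    and p: "1 \<le> p" "p < \<infinity>" "1 / p + 1 / p' = 1"
    and u: "u \<in> Lq p (nl_domain \<Omega> \<delta>)" and v: "v \<in> Lq_vec p' (nl_domain \<Omega> \<delta>)"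
  shows "pairing_vec \<Omega> \<delta> (nl_grad \<Omega> \<delta> \<mu> u) v
            = pairing \<Omega> \<delta> u (\<lambda>x. - nl_div \<Omega> \<delta> \<mu> v x) + correction_A \<Omega> \<delta> \<mu> u v"
proof -
  let ?M = "lborel \<Otimes>\<^sub>M lborel :: ((real ^ 'd) \<times> (real ^ 'd)) measure"
  define W where "W = nl_domain \<Omega> \<delta>"
  have W: "W \<in> sets borel" using open_nl_domain[OF \<Omega>] \<delta> by (simp add: W_def)
  have \<Omega>b: "\<Omega> \<in> sets borel" using \<Omega> by simp
  have \<Omega>W: "\<Omega> \<subseteq> W" by (auto simp: W_def nl_domain_def)
  have collar: "collar \<Omega> \<delta> = W - \<Omega>" by (auto simp: W_def nl_domain_def collar_def)
  have ball: "ball x \<delta> \<subseteq> W" if "x \<in> \<Omega>" for x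
    using that \<delta> by (auto simp: W_def nl_domain_eq)
  have "u \<in> borel_measurable (lebesgue_on W)" using u by (simp add: Lq_def W_def)
  from borel_representative[OF W this] obtain u' where u':
    "u' \<in> borel_measurable borel" "\<And>x. x \<notin> W \<Longrightarrow> u' x = 0" "AE x in lborel. x \<in> W \<longrightarrow> u x = u' x"
    by auto
  have vk: "(\<lambda>x. v x $ k) \<in> Lq p' W" for k using v by (simp add: Lq_vec_def W_def)
  have "\<forall>k. \<exists>v' a b. dominated_pair u' v' a b \<and> (AE x in lborel. x \<in> W \<longrightarrow> v x $ k = v' x)"
    using dual_pair_dominated[OF W p _ vk u'] u by (simp add: W_def)
  from choice[OF this] obtain v' where "\<forall>k. \<exists>a b. dominated_pair u' (v' k) a b \<and>
      (AE x in lborel. x \<in> W \<longrightarrow> v x $ k = v' k x)" ..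
  then have v': "AE x in lborel. x \<in> W \<longrightarrow> v x $ k = v' k x" and "\<exists>a b. dominated_pair u' (v' k) a b" for k
    by auto
  then obtain a b where dominated: "\<And>k. dominated_pair u' (v' k) (a k) (b k)" by metis
  have "\<forall>k. \<exists>m. m \<in> borel_measurable borel \<and> integrable lborel m \<and> (\<forall>z. \<delta> \<le> norm z \<longrightarrow> m z = 0)
    \<and> (AE z in lborel. \<mu> z $ k = m z)"
    using kernel_representative[OF \<mu>] by blast
  from choice[OF this] obtain m where
    "\<forall>k. m k \<in> borel_measurable borel \<and> integrable lborel (m k) \<and> (\<forall>z. \<delta> \<le> norm z \<longrightarrow> m k z = 0)
    \<and> (AE z in lborel. \<mu> z $ k = m k z)" ..
  then have m: "\<And>k. m k \<in> borel_measurable borel" "\<And>k. integrable lborel (m k)"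
    "\<And>k z. \<delta> \<le> norm z \<Longrightarrow> m k z = 0" "\<And>k. AE z in lborel. \<mu> z $ k = m k z"
    by auto
  define s where "s k = even_part (m k)" for k
  have s: "integrable lborel (s k)" "s k \<in> borel_measurable borel"
    "\<delta> \<le> norm z \<Longrightarrow> s k z = 0" for k z
    using integrable_even_part[OF m(2)] even_part_eq_0[of \<delta> "m k" z] m(3) by (auto simp: s_def)
  have s_ae: "AE z in lborel. sym_part \<mu> z $ k = s k z" for k
    using m(4)[of k] AE_lborel_shift(2)[OF m(4)[of k], of 0]
    by eventually_elim (simp add: sym_part_def s_def even_part_def)
  have m_supp: "\<forall>z. \<delta> \<le> norm z \<longrightarrow> m k z = 0" and s_supp: "\<forall>z. \<delta> \<le> norm z \<longrightarrow> s k z = 0" for k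
    using m(3) s(3) by blast+
  interpret dominated_pair u' "v' k" "a k" "b k" for k
    by (rule dominated)

  let ?L = "\<lambda>k. deriv_density \<Omega> W (m k) u' (v' k)" and ?D = "\<lambda>k. deriv_density \<Omega> W (m k) (v' k) u'"
  let ?S = "\<lambda>k. deriv_density \<Omega> W (s k) (v' k) u'" and ?C = "\<lambda>k. collar_density \<Omega> W (m k) u' (v' k)"
  note int_L = integrable_deriv_density(1)[OF \<Omega>b W m(2)] and int_D = integrable_deriv_density(2)[OF \<Omega>b W m(2)]
    and int_S = integrable_deriv_density(2)[OF \<Omega>b W s(1)] and int_C = integrable_collar_density[OF \<Omega>b W m(2)]

  have grad: "pairing_vec \<Omega> \<delta> (nl_grad \<Omega> \<delta> \<mu> u) v = (\<Sum>k\<in>UNIV. integral\<^sup>L ?M (case_prod (?L k)))"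
    unfolding pairing_vec_def nl_grad_def
  proof (rule sum.cong[OF refl])
    fix k
    note nl_deriv_times_AE[OF \<Omega> \<delta> m(1)[of k] u'(1) m_supp m(4)[of k] u'(3)[unfolded W_def] v'[of k, unfolded W_def]]
    from pairing_nl_deriv_eq_density[OF \<Omega> \<delta> this] int_L[of k k]
    show "pairing \<Omega> \<delta> (\<lambda>x. (\<chi> k. nl_deriv \<Omega> \<delta> (\<lambda>z. \<mu> z $ k) u x) $ k) (\<lambda>x. v x $ k)
        = integral\<^sup>L ?M (case_prod (?L k))"
      by (simp add: W_def)
  qed

  have sym: "pairing \<Omega> \<delta> u (nl_deriv \<Omega> \<delta> (\<lambda>z. sym_part \<mu> z $ k) (\<lambda>x. v x $ k)) = integral\<^sup>L ?M (case_prod (?S k))" for k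
  proof -
    note nl_deriv_times_AE[OF \<Omega> \<delta> s(2)[of k] v_borel[of k] s_supp s_ae[of k] v'[of k, unfolded W_def] u'(3)[unfolded W_def]]
    from pairing_nl_deriv_eq_density[OF \<Omega> \<delta> this] int_S[of k k]
    show ?thesis by (simp add: W_def pairing_def mult.commute)
  qed

  have div: "pairing \<Omega> \<delta> u (\<lambda>x. - nl_div \<Omega> \<delta> \<mu> v x) = - (\<Sum>k\<in>UNIV. integral\<^sup>L ?M (case_prod (?D k)))"
  proof -
    have "AE x in lborel. indicator W x * (nl_deriv \<Omega> \<delta> (\<lambda>z. \<mu> z $ k) (\<lambda>y. v y $ k) x * u x)
        = (\<integral>y. ?D k x y \<partial>lborel)" for k
      using nl_deriv_times_AE[OF \<Omega> \<delta> m(1)[of k] v_borel[of k] m_supp m(4)[of k] v'[of k, unfolded W_def] u'(3)[unfolded W_def]]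
      by (simp add: W_def)
    then have "AE x in lborel. \<forall>k. indicator W x * (nl_deriv \<Omega> \<delta> (\<lambda>z. \<mu> z $ k) (\<lambda>y. v y $ k) x * u x)
        = (\<integral>y. ?D k x y \<partial>lborel)"
      by (simp add: AE_all_countable)
    then have ae: "AE x in lborel. indicator W x * (u x * - nl_div \<Omega> \<delta> \<mu> v x) = - (\<Sum>k\<in>UNIV. \<integral>y. ?D k x y \<partial>lborel)"
    proof eventually_elim
      case (elim x)
      then have "(\<Sum>k\<in>UNIV. \<integral>y. ?D k x y \<partial>lborel)
          = (\<Sum>k\<in>UNIV. indicator W x * (nl_deriv \<Omega> \<delta> (\<lambda>z. \<mu> z $ k) (\<lambda>y. v y $ k) x * u x))"
        by simp
      then show ?case by (simp add: nl_div_def sum_distrib_left mult_ac)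
    qed
    have "pairing \<Omega> \<delta> u (\<lambda>x. - nl_div \<Omega> \<delta> \<mu> v x) = (\<integral>x. - (\<Sum>k\<in>UNIV. \<integral>y. ?D k x y \<partial>lborel) \<partial>lborel)"
      unfolding pairing_def W_def[symmetric]
      using borel_measurable_integrable[OF lborel_pair.integrable_fst[OF int_D]]
      by (intro integral_lebesgue_on_eq_lborel[OF W _ ae]) simp
    also have "\<dots> = - (\<Sum>k\<in>UNIV. \<integral>x. \<integral>y. ?D k x y \<partial>lborel \<partial>lborel)"
      using lborel_pair.integrable_fst[OF int_D] by (simp add: Bochner_Integration.integral_sum)
    finally show ?thesis using lborel_pair.integral_fst[OF int_D] by simp
  qed

  let ?F = "\<lambda>x y. (u y *\<^sub>R v x + u x *\<^sub>R v y) \<bullet> \<mu> (y - x) - 2 * u x * (v y \<bullet> sym_part \<mu> (y - x))"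
  have corr: "(\<integral>x. (\<integral>y. ?F x y \<partial>lebesgue_on (collar \<Omega> \<delta>)) \<partial>lebesgue_on (inner_collar \<Omega> \<delta>))
      = (\<Sum>k\<in>UNIV. integral\<^sup>L ?M (case_prod (?C k)))"
  proof -
    have v'_all: "AE x in lborel. \<forall>k. x \<in> W \<longrightarrow> v x $ k = v' k x"
      and m_all: "AE z in lborel. \<forall>k. \<mu> z $ k = m k z"
      and s_all: "AE z in lborel. \<forall>k. sym_part \<mu> z $ k = s k z"
      unfolding AE_all_countable using v' m(4) s_ae by auto
    have C_all: "AE x in lborel. \<forall>k. integrable lborel (?C k x)"
      using lborel_pair.AE_integrable_fst[OF int_C] by (simp add: AE_all_countable)
    have G: "W - \<Omega> \<in> sets borel" using W \<Omega>b by auto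
    have ae: "AE x in lborel. indicator (inner_collar \<Omega> \<delta>) x * (\<integral>y. ?F x y \<partial>lebesgue_on (collar \<Omega> \<delta>))
        = (\<Sum>k\<in>UNIV. \<integral>y. ?C k x y \<partial>lborel)"
      using u'(3) v'_all C_all
    proof eventually_elim
      case x: (elim x)
      show ?case
      proof (cases "x \<in> inner_collar \<Omega> \<delta>")
        case False
        \<comment> \<open>A point of \<open>\<Omega>\<close> outside the inner collar has distance at least \<open>\<delta>\<close> from the collar.\<close>
        have "?C k x y = 0" for k y
        proof (cases "x \<in> \<Omega> \<and> y \<in> W - \<Omega>")
          case True
          then have "\<delta> \<le> norm (y - x)" using inner_collarI[of x \<Omega> y \<delta>] False
            by (force simp: dist_norm norm_minus_commute)
          then show ?thesis using m(3) s(3)[of "y - x" k] by (simp add: collar_density_def s_def)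
        qed (auto simp: collar_density_def)
        then show ?thesis using False by simp
      next
        case True
        then have x\<Omega>: "x \<in> \<Omega>" and xW: "x \<in> W" using \<Omega>W by (auto simp: inner_collar_def)
        have "(\<integral>y. ?F x y \<partial>lebesgue_on (collar \<Omega> \<delta>)) = (\<integral>y. (\<Sum>k\<in>UNIV. ?C k x y) \<partial>lborel)"
          unfolding collar
        proof (rule integral_lebesgue_on_eq_lborel[OF G])
          have "?C k x \<in> borel_measurable borel" for k
            using x(3) borel_measurable_integrable[of lborel] by auto
          then show "(\<lambda>y. \<Sum>k\<in>UNIV. ?C k x y) \<in> borel_measurable borel" by simp
          show "AE y in lborel. indicator (W - \<Omega>) y * ?F x y = (\<Sum>k\<in>UNIV. ?C k x y)"
            using u'(3) v'_all AE_lborel_shift(1)[OF m_all, of x] AE_lborel_shift(1)[OF s_all, of x]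
          proof eventually_elim
            case (elim y)
            show ?case
            proof (cases "y \<in> W - \<Omega>")
              case True
              have "?F x y = (\<Sum>k\<in>UNIV. (u' y * v' k x + u' x * v' k y) * m k (y - x) - 2 * u' x * v' k y * s k (y - x))"
                using elim True x xW
                by (simp add: inner_vec_def sum_subtractf sum_distrib_left mult.assoc)
              then show ?thesis using True x\<Omega> by (simp add: collar_density_def s_def)
            qed (auto simp: collar_density_def)
          qed
        qed
        also have "\<dots> = (\<Sum>k\<in>UNIV. \<integral>y. ?C k x y \<partial>lborel)"
          using x(3) by (intro Bochner_Integration.integral_sum) auto
        finally show ?thesis using True by simp
      qed
    qed
    have "(\<integral>x. (\<integral>y. ?F x y \<partial>lebesgue_on (collar \<Omega> \<delta>)) \<partial>lebesgue_on (inner_collar \<Omega> \<delta>))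
        = (\<integral>x. (\<Sum>k\<in>UNIV. \<integral>y. ?C k x y \<partial>lborel) \<partial>lborel)"
      using borel_measurable_integrable[OF lborel_pair.integrable_fst[OF int_C]]
      by (intro integral_lebesgue_on_eq_lborel[OF inner_collar_borel[OF \<Omega>] _ ae]) simp
    also have "\<dots> = (\<Sum>k\<in>UNIV. \<integral>x. \<integral>y. ?C k x y \<partial>lborel \<partial>lborel)"
      using lborel_pair.integrable_fst[OF int_C] by (intro Bochner_Integration.integral_sum)
    finally show ?thesis using lborel_pair.integral_fst[OF int_C] by simp
  qed

  have "integral\<^sup>L ?M (case_prod (?L k)) = - integral\<^sup>L ?M (case_prod (?D k)) + integral\<^sup>L ?M (case_prod (?C k))
      + 2 * integral\<^sup>L ?M (case_prod (?S k))" for k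
    unfolding s_def by (rule integral_deriv_density_by_parts[OF \<Omega>b W \<Omega>W ball m(2) m(3)])
  then show ?thesis
    unfolding grad div correction_A_def corr sym
    by (simp add: sum.distrib sum_subtractf sum_negf)
qed

section \<open>Antisymmetric kernels\<close>

lemma AE_sym_part_eq_0:
  assumes "antisym_components \<mu>"
  shows "AE z in lborel. sym_part \<mu> z = 0"
proof -
  have "AE z in lborel. \<forall>k. \<mu> (- z) $ k = - (\<mu> z $ k)"
    using assms by (simp add: antisym_components_def AE_all_countable AE_completion_iff)
  then show ?thesis by eventually_elim (simp add: sym_part_def vec_eq_iff)
qed

lemma nl_deriv_AE_zero_kernel:
  fixes \<Omega> :: "'a::euclidean_space set"
  assumes "open \<Omega>" "\<delta> > 0" "AE z in lborel. \<mu> z = 0"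
  shows "nl_deriv \<Omega> \<delta> \<mu> f x = 0"
proof -
  let ?W = "nl_domain \<Omega> \<delta>"
  have W: "?W \<in> sets lebesgue" using open_nl_domain[OF assms(1)] assms(2) by simp
  have "AE y in lebesgue. \<mu> (y - x) = 0" by (rule AE_completion[OF AE_lborel_shift(1)[OF assms(3)]])
  then have "AE y in lebesgue. y \<in> ?W \<longrightarrow> (f y - f x) * \<mu> (y - x) * indicator (ball x \<delta>) y = 0"
    by eventually_elim simp
  then have "AE y in lebesgue_on ?W. (f y - f x) * \<mu> (y - x) * indicator (ball x \<delta>) y = 0"
    using W by (simp add: AE_restrict_space_iff)
  then show ?thesis unfolding nl_deriv_def by (subst integral_eq_zero_AE) auto
qed

lemma const_in_Lq:
  assumes "S \<in> sets lebesgue" "bounded S" "q \<noteq> \<infinity>"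
  shows "(\<lambda>_. c) \<in> Lq q S"
proof -
  have "S \<in> lmeasurable" using assms bounded_set_imp_lmeasurable by blast
  then have "finite_measure (lebesgue_on S)" by (simp add: finite_measure_lebesgue_on)
  then show ?thesis using assms(3) by (simp add: Lq_def finite_measure.integrable_const)
qed

lemma correction_A_antisym:
  fixes \<mu> :: "real ^ 'd \<Rightarrow> real ^ 'd"
  assumes \<Omega>: "open \<Omega>" and \<delta>: "\<delta> > 0" and anti: "antisym_components \<mu>"
  shows "correction_A \<Omega> \<delta> \<mu> u v
    = (\<integral>x. (\<integral>y. (u y *\<^sub>R v x + u x *\<^sub>R v y) \<bullet> \<mu> (y - x) \<partial>lebesgue_on (collar \<Omega> \<delta>)) \<partial>lebesgue_on (inner_collar \<Omega> \<delta>))"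
proof -
  have "AE z in lborel. sym_part \<mu> z $ k = 0" for k
    using AE_sym_part_eq_0[OF anti] by eventually_elim simp
  then have d: "nl_deriv \<Omega> \<delta> (\<lambda>z. sym_part \<mu> z $ k) f x = 0" for k f x
    by (rule nl_deriv_AE_zero_kernel[OF \<Omega> \<delta>])
  have G: "collar \<Omega> \<delta> \<in> sets lebesgue"
  proof -
    have "collar \<Omega> \<delta> = nl_domain \<Omega> \<delta> - \<Omega>" by (auto simp: nl_domain_def collar_def)
    then show ?thesis using open_nl_domain[OF \<Omega>] \<delta> \<Omega> by simp
  qed
  have "(\<integral>y. (u y *\<^sub>R v x + u x *\<^sub>R v y) \<bullet> \<mu> (y - x) - 2 * u x * (v y \<bullet> sym_part \<mu> (y - x)) \<partial>lebesgue_on (collar \<Omega> \<delta>))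
      = (\<integral>y. (u y *\<^sub>R v x + u x *\<^sub>R v y) \<bullet> \<mu> (y - x) \<partial>lebesgue_on (collar \<Omega> \<delta>))" for x
  proof (rule integral_lebesgue_on_cong_AE[OF G])
    show "AE y in lborel. y \<in> collar \<Omega> \<delta> \<longrightarrow>
       (u y *\<^sub>R v x + u x *\<^sub>R v y) \<bullet> \<mu> (y - x) - 2 * u x * (v y \<bullet> sym_part \<mu> (y - x))
       = (u y *\<^sub>R v x + u x *\<^sub>R v y) \<bullet> \<mu> (y - x)"
      using AE_lborel_shift(1)[OF AE_sym_part_eq_0[OF anti], of x] by eventually_elim simp
  qed
  then show ?thesis by (simp add: correction_A_def d pairing_def)
qed

theorem proposition3p9:
  fixes \<Omega> :: "(real ^ 'd) set" and \<delta> :: real and \<mu> :: "real ^ 'd \<Rightarrow> real ^ 'd"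
    and p p' :: ennreal
  assumes "open \<Omega>" and "bounded \<Omega>" and "\<delta> > 0"
    and "\<And>k. integrable lebesgue (\<lambda>z. \<mu> z $ k)"
    and "ess_supp \<mu> \<subseteq> cball 0 \<delta>"
    and "1 \<le> p" and "p < \<infinity>" and "1 / p + 1 / p' = 1"
  shows "(\<forall>u \<in> Lq p (nl_domain \<Omega> \<delta>). \<forall>v \<in> Lq_vec p' (nl_domain \<Omega> \<delta>).
            pairing_vec \<Omega> \<delta> (nl_grad \<Omega> \<delta> \<mu> u) v
            = pairing \<Omega> \<delta> u (\<lambda>x. - nl_div \<Omega> \<delta> \<mu> v x) + correction_A \<Omega> \<delta> \<mu> u v)
       \<and> (antisym_components \<mu> \<longrightarrow>
            (\<forall>u \<in> Lq0 p \<Omega> \<delta>. \<forall>v \<in> Lq0_vec p' \<Omega> \<delta>.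
              pairing_vec \<Omega> \<delta> (nl_grad \<Omega> \<delta> \<mu> u) v
              = pairing \<Omega> \<delta> u (\<lambda>x. - nl_div \<Omega> \<delta> \<mu> v x)))
       \<and> (antisym_components \<mu> \<longrightarrow>
            (\<forall>v \<in> Lq_vec p' (nl_domain \<Omega> \<delta>).
              (\<integral>x. nl_div \<Omega> \<delta> \<mu> v x \<partial>lebesgue_on (nl_domain \<Omega> \<delta>))
              = (\<integral>x. (\<integral>y. (v x + v y) \<bullet> \<mu> (y - x) \<partial>lebesgue_on (collar \<Omega> \<delta>))
                   \<partial>lebesgue_on (inner_collar \<Omega> \<delta>))))"
proof (intro conjI impI ballI)
  note green = nonlocal_green_identity[OF assms(1,3-8)]
  show "pairing_vec \<Omega> \<delta> (nl_grad \<Omega> \<delta> \<mu> u) v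
      = pairing \<Omega> \<delta> u (\<lambda>x. - nl_div \<Omega> \<delta> \<mu> v x) + correction_A \<Omega> \<delta> \<mu> u v"
    if "u \<in> Lq p (nl_domain \<Omega> \<delta>)" "v \<in> Lq_vec p' (nl_domain \<Omega> \<delta>)" for u v
    using green[OF that] .
  show "pairing_vec \<Omega> \<delta> (nl_grad \<Omega> \<delta> \<mu> u) v = pairing \<Omega> \<delta> u (\<lambda>x. - nl_div \<Omega> \<delta> \<mu> v x)"
    if anti: "antisym_components \<mu>" and u: "u \<in> Lq0 p \<Omega> \<delta>" and v: "v \<in> Lq0_vec p' \<Omega> \<delta>" for u v
  proof -
    have "AE y in lebesgue_on (collar \<Omega> \<delta>). \<forall>k. v y $ k = 0"
      using v by (simp add: Lq0_vec_def Lq0_def AE_all_countable)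
    moreover have "AE y in lebesgue_on (collar \<Omega> \<delta>). u y = 0" using u by (simp add: Lq0_def)
    ultimately have "AE y in lebesgue_on (collar \<Omega> \<delta>). (u y *\<^sub>R v x + u x *\<^sub>R v y) \<bullet> \<mu> (y - x) = 0" for x
      by eventually_elim (simp add: inner_vec_def)
    then have "correction_A \<Omega> \<delta> \<mu> u v = 0"
      by (simp add: correction_A_antisym[OF assms(1,3) anti] integral_eq_zero_AE)
    moreover have "u \<in> Lq p (nl_domain \<Omega> \<delta>)" "v \<in> Lq_vec p' (nl_domain \<Omega> \<delta>)"
      using u v by (auto simp: Lq0_def Lq0_vec_def Lq_vec_def)
    ultimately show ?thesis using green by simp
  qed
  show "(\<integral>x. nl_div \<Omega> \<delta> \<mu> v x \<partial>lebesgue_on (nl_domain \<Omega> \<delta>))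
      = (\<integral>x. (\<integral>y. (v x + v y) \<bullet> \<mu> (y - x) \<partial>lebesgue_on (collar \<Omega> \<delta>)) \<partial>lebesgue_on (inner_collar \<Omega> \<delta>))"
    if anti: "antisym_components \<mu>" and v: "v \<in> Lq_vec p' (nl_domain \<Omega> \<delta>)" for v
  proof -
    have "nl_domain \<Omega> \<delta> \<in> sets lebesgue" using open_nl_domain[OF assms(1)] assms(3) by simp
    then have "(\<lambda>_. 1) \<in> Lq p (nl_domain \<Omega> \<delta>)"
      using bounded_nl_domain[OF assms(2)] assms(3,7) by (intro const_in_Lq) auto
    \<comment> \<open>The gradient of the constant 1 vanishes and its pairing with the divergence is the integral on the left.\<close>
    from green[OF this v] show ?thesis
      by (simp add: correction_A_antisym[OF assms(1,3) anti] pairing_vec_def pairing_def nl_grad_def nl_deriv_def)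
  qed
qed

end
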